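(* Let $d \ge 3$ be odd and let $k$ be an even positive integer. If $AT_d(k) \neq 0$, then $g_d(n,k) > 0$ for all integers $1 \le n \le k^{d-1}$.
   Context: For positive integers $n, k$, let $G = \mathrm{SL}(n)^{\times d}$ act on $V = (\mathbb{C}^n)^{\otimes d}$ factorwise, and let $g_d(n,k) := \dim \mathbb{C}[V]^G_{nk}$ be the dimension of the space of $G$-invariant homogeneous polynomials of degree $nk$ on $V$ (equivalently, the generalized Kronecker coefficient $g(\lambda,\ldots,\lambda)$ with $d$ arguments, where $\lambda = (k,\ldots,k)$ has $n$ parts). Elements of $[k]^d$ are called cells and are ordered lexicographically. A slice of $[k]^d$ is the set of all cells whose $\ell$-th coordinate equals a fixed value, for some direction $\ell \in [d]$. A $d$-dimensional Latin hypercube of length $k$ is a function $C : [k]^d \to [k^{d-1}]$ such that for every slice $A$, the values $C(a)$, $a \in A$, listed in lexicographic order of $a$, form a permutation of $[k^{d-1}]$. Its sign $\mathrm{sgn}(C)$ is the product of the signs of these permutations over all $dk$ slices. Define $AT_d(k) := \sum_C \mathrm{sgn}(C)$, summed over all $d$-dimensional Latin hypercubes of length $k$. *)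

theory Defs
  imports
    Complex_Main
    "HOL-Library.FuncSet"
    "HOL-Library.List_Lexorder"
    "HOL-Library.Function_Algebras"
    "HOL-Combinatorics.Permutations"
    "Jordan_Normal_Form.Determinant"
begin

text \<open>
  All index ranges are zero-based: \<open>[m]\<close> is \<open>{..<m}\<close>, and \<open>[m]\<^sup>d\<close> is the set of
  lists of length \<open>d\<close> over it. The order on lists is the lexicographic one of
  \<^theory>\<open>HOL-Library.List_Lexorder\<close>. The same set indexes the coordinates of a tensor.
\<close>

definition cells :: "nat \<Rightarrow> nat \<Rightarrow> nat list set" where
  "cells d m = {a. length a = d \<and> set a \<subseteq> {..<m}}"


subsection \<open>Latin hypercubes\<close>

definition slice :: "nat \<Rightarrow> nat \<Rightarrow> nat \<Rightarrow> nat \<Rightarrow> nat list set" where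
  "slice d k l c = {a \<in> cells d k. a ! l = c}"

text \<open>
  The values of \<open>C\<close> on a slice, listed in lexicographic order of the cells, read as a map
  from positions to values; it is extended by the identity beyond the \<open>k ^ (d - 1)\<close>
  positions because \<^const>\<open>permutes\<close> and \<^const>\<open>sign\<close> concern maps on the whole type.
\<close>

definition slice_word :: "nat \<Rightarrow> nat \<Rightarrow> (nat list \<Rightarrow> nat) \<Rightarrow> nat \<Rightarrow> nat \<Rightarrow> nat \<Rightarrow> nat" where
  "slice_word d k C l c =
    (\<lambda>i. if i < k ^ (d - 1) then C (sorted_list_of_set (slice d k l c) ! i) else i)"

definition latin_hypercubes :: "nat \<Rightarrow> nat \<Rightarrow> (nat list \<Rightarrow> nat) set" where
  "latin_hypercubes d k =
    {C \<in> cells d k \<rightarrow>\<^sub>E {..<k ^ (d - 1)}.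
      \<forall>l<d. \<forall>c<k. slice_word d k C l c permutes {..<k ^ (d - 1)}}"

definition hypercube_sign :: "nat \<Rightarrow> nat \<Rightarrow> (nat list \<Rightarrow> nat) \<Rightarrow> int" where
  "hypercube_sign d k C = (\<Prod>l<d. \<Prod>c<k. sign (slice_word d k C l c))"

definition AT :: "nat \<Rightarrow> nat \<Rightarrow> int" where
  "AT d k = (\<Sum>C\<in>latin_hypercubes d k. hypercube_sign d k C)"


subsection \<open>Invariant polynomials on tensors\<close>

definition SL :: "nat \<Rightarrow> complex mat set" where
  "SL n = {A \<in> carrier_mat n n. det A = 1}"

text \<open>
  A tensor in \<open>(\<complex>\<^sup>n)\<^sup>\<otimes>\<^sup>d\<close> is given by its coordinates in the standard basis, indexed by
  \<open>cells d n\<close> and set to zero outside.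
\<close>

definition tensors :: "nat \<Rightarrow> nat \<Rightarrow> (nat list \<Rightarrow> complex) set" where
  "tensors d n = {T. \<forall>a. a \<notin> cells d n \<longrightarrow> T a = 0}"

text \<open>The action of \<open>g 0 \<otimes> \<dots> \<otimes> g (d - 1)\<close> in coordinates.\<close>

definition tensor_act ::
  "nat \<Rightarrow> nat \<Rightarrow> (nat \<Rightarrow> complex mat) \<Rightarrow> (nat list \<Rightarrow> complex) \<Rightarrow> nat list \<Rightarrow> complex" where
  "tensor_act d n g T =
    (\<lambda>a. if a \<in> cells d n
         then \<Sum>b\<in>cells d n. (\<Prod>l<d. g l $$ (a ! l, b ! l)) * T b
         else 0)"

definition fun_scale :: "complex \<Rightarrow> ('a \<Rightarrow> complex) \<Rightarrow> 'a \<Rightarrow> complex" where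
  "fun_scale c f = (\<lambda>x. c * f x)"

interpretation cfun: vector_space fun_scale
  by unfold_locales (auto simp: fun_scale_def algebra_simps)

text \<open>
  As \<open>\<complex>\<close> is infinite, polynomials on \<open>(\<complex>\<^sup>n)\<^sup>\<otimes>\<^sup>d\<close> are identified with polynomial functions
  of the coordinates. The functions are defined on the whole type \<^typ>\<open>nat list \<Rightarrow> complex\<close>
  but only depend on the coordinates in \<open>cells d n\<close>, so each is determined by its
  restriction to \<^term>\<open>tensors d n\<close>, and dimensions are not affected by the larger domain.
\<close>

definition homogeneous_polys ::
  "nat \<Rightarrow> nat \<Rightarrow> nat \<Rightarrow> ((nat list \<Rightarrow> complex) \<Rightarrow> complex) set" where
  "homogeneous_polys d n m =
    cfun.span {(\<lambda>T. \<Prod>a\<in>cells d n. T a ^ e a) |e. (\<Sum>a\<in>cells d n. e a) = m}"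

definition invariant_polys ::
  "nat \<Rightarrow> nat \<Rightarrow> nat \<Rightarrow> ((nat list \<Rightarrow> complex) \<Rightarrow> complex) set" where
  "invariant_polys d n m =
    {f \<in> homogeneous_polys d n m.
      \<forall>g T. (\<forall>l<d. g l \<in> SL n) \<longrightarrow> T \<in> tensors d n \<longrightarrow> f (tensor_act d n g T) = f T}"

definition gen_kronecker :: "nat \<Rightarrow> nat \<Rightarrow> nat \<Rightarrow> nat" where
  "gen_kronecker d n k = cfun.dim (invariant_polys d n (n * k))"

end

theory Submission imports Defs begin

text \<open>
  Let \<open>N = k ^ (d - 1)\<close>. The fundamental invariant \<open>latin_form\<close> of degree \<open>N * k\<close> on
  \<open>(\<complex>\<^sup>N)\<^sup>\<otimes>\<^sup>d\<close> labels the cells of \<open>[k]\<^sup>d\<close> once for every direction \<open>l\<close>, each slice in direction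
  \<open>l\<close> carrying a permutation of \<open>[N]\<close>, and sums the signed products of the corresponding
  coordinates. It is a contraction with determinants, hence \<open>SL(N)\<^sup>d\<close>-invariant, and at the unit
  tensor it equals \<open>AT d k\<close>. For \<open>n \<le> N\<close> evaluate it at \<open>T \<oplus> I\<close>, where \<open>T\<close> is a tensor over
  \<open>\<complex>\<^sup>n\<close> and \<open>I\<close> is the unit tensor on the remaining \<open>N - n\<close> basis vectors. This is
  \<open>SL(n)\<^sup>d\<close>-invariant, its value at the unit tensor over \<open>\<complex>\<^sup>n\<close> is again \<open>AT d k\<close>, and it is
  homogeneous of degree \<open>n * k\<close>: each of the \<open>k\<close> slices in direction \<open>0\<close> carries exactly \<open>n\<close>
  labels below \<open>n\<close>, and the cells with these labels are the ones that contribute a coordinate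
  of \<open>T\<close>.
\<close>

section \<open>Cells and their decomposition into slices\<close>

lemma finite_cells [simp]: "finite (cells d m)"
  unfolding cells_def using finite_lists_length_eq[of "{..<m}" d] by (simp only: conj_commute finite_lessThan)

lemma cells_iff: "a \<in> cells d m \<longleftrightarrow> length a = d \<and> (\<forall>l<d. a ! l < m)"
  unfolding cells_def by (auto simp: set_conv_nth subset_iff)

lemma nth_cells: "a \<in> cells d m \<Longrightarrow> l < d \<Longrightarrow> a ! l < m"
  by (simp add: cells_iff)

lemma finite_slice [simp]: "finite (slice d k l c)"
  unfolding slice_def by simp

text \<open>Deleting the coordinate \<open>l\<close> maps the slice bijectively onto
  \<open>cells (d - 1) k\<close>; inserting \<open>c\<close> at position \<open>l\<close> is the
  inverse.\<close>

lemma card_slice: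
  assumes "l < d" "c < k"
  shows "card (slice d k l c) = k ^ (d - 1)"
proof -
  have "bij_betw (\<lambda>x. take l x @ c # drop l x) (cells (d - 1) k) (slice d k l c)"
  proof (rule bij_betw_byWitness[where f' = "\<lambda>a. take l a @ drop (Suc l) a"])
    show "\<forall>x\<in>cells (d - 1) k. take l (take l x @ c # drop l x) @ drop (Suc l) (take l x @ c # drop l x) = x"
      using assms by (auto simp: cells_def)
    show "\<forall>a\<in>slice d k l c. take l (take l a @ drop (Suc l) a) @ c # drop l (take l a @ drop (Suc l) a) = a"
      using assms by (auto simp: cells_def slice_def min_def id_take_nth_drop[symmetric])
    show "(\<lambda>x. take l x @ c # drop l x) ` cells (d - 1) k \<subseteq> slice d k l c"
    proof (rule image_subsetI)
      fix x assume x: "x \<in> cells (d - 1) k"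
      then have "set (take l x) \<subseteq> {..<k}" "set (drop l x) \<subseteq> {..<k}"
        using set_take_subset[of l x] set_drop_subset[of l x] by (auto simp: cells_def)
      then show "take l x @ c # drop l x \<in> slice d k l c"
        using assms x by (simp add: cells_def slice_def nth_append)
    qed
    show "(\<lambda>a. take l a @ drop (Suc l) a) ` slice d k l c \<subseteq> cells (d - 1) k"
    proof (rule image_subsetI)
      fix a assume a: "a \<in> slice d k l c"
      then have "set (take l a) \<subseteq> {..<k}" "set (drop (Suc l) a) \<subseteq> {..<k}"
        using set_take_subset[of l a] set_drop_subset[of "Suc l" a] by (auto simp: cells_def slice_def)
      then show "take l a @ drop (Suc l) a \<in> cells (d - 1) k"
        using assms a by (simp add: cells_def slice_def)
    qed
  qed
  then have "card (slice d k l c) = card (cells (d - 1) k)"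
    by (simp add: bij_betw_same_card)
  also have "\<dots> = k ^ (d - 1)"
    unfolding cells_def using card_lists_length_eq[of "{..<k}" "d - 1"]
    by (simp only: conj_commute finite_lessThan card_lessThan)
  finally show ?thesis .
qed

text \<open>The enumeration hidden in \<open>slice_word\<close>, separated from the labelling so
  that it can be used for reindexing.\<close>

definition slice_cell :: "nat \<Rightarrow> nat \<Rightarrow> nat \<Rightarrow> nat \<Rightarrow> nat \<Rightarrow> nat list" where
  "slice_cell d k l c i = sorted_list_of_set (slice d k l c) ! i"

lemma slice_word_eq:
  "slice_word d k C l c i = (if i < k ^ (d - 1) then C (slice_cell d k l c i) else i)"
  by (simp add: slice_word_def slice_cell_def)

lemma bij_betw_slice_cell:
  assumes "l < d" "c < k"
  shows "bij_betw (slice_cell d k l c) {..<k ^ (d - 1)} (slice d k l c)"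
  unfolding slice_cell_def
  using bij_betw_nth[of "sorted_list_of_set (slice d k l c)" "{..<k ^ (d - 1)}" "slice d k l c"]
    card_slice[OF assms] by simp

lemma slice_cell_in:
  assumes "l < d" "c < k" "i < k ^ (d - 1)"
  shows "slice_cell d k l c i \<in> cells d k" "slice_cell d k l c i ! l = c"
  using bij_betwE[OF bij_betw_slice_cell[OF assms(1,2)]] assms(3) by (auto simp: slice_def)

lemma slice_cell_exhaust:
  assumes "l < d" "a \<in> cells d k"
  obtains i where "i < k ^ (d - 1)" "a = slice_cell d k l (a ! l) i"
  using bij_betw_slice_cell[OF assms(1) nth_cells[OF assms(2,1)]] assms(2)
  unfolding slice_def bij_betw_def by blast

text \<open>The slices in one direction partition the cells. Stated for any commutative monoid, so
  that it serves products over cells as well as the counting sum in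
  \<open>card_small_entries\<close>.\<close>

lemma (in comm_monoid_set) cells_slices:
  assumes "l < d"
  shows "F h (cells d k) = F (\<lambda>c. F (\<lambda>i. h (slice_cell d k l c i)) {..<k ^ (d - 1)}) {..<k}"
proof -
  have "F h (cells d k) = F (\<lambda>c. F h {a \<in> cells d k. a ! l = c}) {..<k}"
    by (rule group[symmetric]) (use assms nth_cells in auto)
  also have "\<dots> = F (\<lambda>c. F (\<lambda>i. h (slice_cell d k l c i)) {..<k ^ (d - 1)}) {..<k}"
    using reindex_bij_betw[OF bij_betw_slice_cell[OF assms], symmetric, of _ k h]
    by (intro cong) (auto simp: slice_def)
  finally show ?thesis .
qed

section \<open>Labellings that are Latin in a single direction\<close>

text \<open>The Latin condition for direction \<open>l\<close> alone; a labelling satisfying it for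
  all \<open>l < d\<close> is a Latin hypercube.\<close>

definition direction_latin :: "nat \<Rightarrow> nat \<Rightarrow> nat \<Rightarrow> (nat list \<Rightarrow> nat) set" where
  "direction_latin d k l =
    {\<sigma> \<in> cells d k \<rightarrow>\<^sub>E {..<k ^ (d - 1)}.
      \<forall>c<k. slice_word d k \<sigma> l c permutes {..<k ^ (d - 1)}}"

lemma finite_direction_latin [simp]: "finite (direction_latin d k l)"
  unfolding direction_latin_def by (rule finite_subset[OF _ finite_PiE[of "cells d k" "\<lambda>_. {..<k ^ (d - 1)}"]]) auto

text \<open>Slices in direction \<open>l\<close> are disjoint and cover all cells, so such a
  labelling amounts to a free choice of one permutation per slice. Sums over these labellings
  therefore factor over the slices.\<close>

lemma bij_betw_slice_words:
  assumes "l < d"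
  shows "bij_betw (\<lambda>\<sigma>. \<lambda>c\<in>{..<k}. slice_word d k \<sigma> l c) (direction_latin d k l)
    ({..<k} \<rightarrow>\<^sub>E {p. p permutes {..<k ^ (d - 1)}})"
  unfolding bij_betw_def
proof
  let ?N = "k ^ (d - 1)"
  show "inj_on (\<lambda>\<sigma>. \<lambda>c\<in>{..<k}. slice_word d k \<sigma> l c) (direction_latin d k l)"
  proof (rule inj_onI)
    fix \<sigma> \<tau>
    assume st: "\<sigma> \<in> direction_latin d k l" "\<tau> \<in> direction_latin d k l"
      and eq: "(\<lambda>c\<in>{..<k}. slice_word d k \<sigma> l c) = (\<lambda>c\<in>{..<k}. slice_word d k \<tau> l c)"
    show "\<sigma> = \<tau>"
    proof (rule PiE_ext)
      show "\<sigma> \<in> cells d k \<rightarrow>\<^sub>E {..<?N}" "\<tau> \<in> cells d k \<rightarrow>\<^sub>E {..<?N}"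
        using st by (auto simp: direction_latin_def)
      fix a assume a: "a \<in> cells d k"
      obtain i where i: "i < ?N" "a = slice_cell d k l (a ! l) i"
        using slice_cell_exhaust[OF assms a] .
      have "slice_word d k \<sigma> l (a ! l) i = slice_word d k \<tau> l (a ! l) i"
        using fun_cong[OF eq, of "a ! l"] nth_cells[OF a assms] by simp
      then show "\<sigma> a = \<tau> a" using i by (simp add: slice_word_eq)
    qed
  qed
  show "(\<lambda>\<sigma>. \<lambda>c\<in>{..<k}. slice_word d k \<sigma> l c) ` direction_latin d k l
    = {..<k} \<rightarrow>\<^sub>E {p. p permutes {..<?N}}"
  proof (intro equalityI subsetI)
    fix p assume p: "p \<in> {..<k} \<rightarrow>\<^sub>E {p. p permutes {..<?N}}"
    \<comment> \<open>The label of a cell is the value of its slice's permutation at the position of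
      the cell within that slice.\<close>
    define \<sigma> where "\<sigma> = (\<lambda>a\<in>cells d k. p (a ! l) (inv_into {..<?N} (slice_cell d k l (a ! l)) a))"
    have w: "slice_word d k \<sigma> l c = p c" if c: "c < k" for c
    proof
      fix i
      have pc: "p c permutes {..<?N}" using p c by auto
      show "slice_word d k \<sigma> l c i = p c i"
      proof (cases "i < ?N")
        case True
        have "inv_into {..<?N} (slice_cell d k l c) (slice_cell d k l c i) = i"
          using bij_betw_slice_cell[OF assms c] True by (simp add: bij_betw_def inv_into_f_f)
        then show ?thesis
          using True slice_cell_in[OF assms c True] by (simp add: slice_word_eq \<sigma>_def)
      next
        case False
        then show ?thesis using permutes_not_in[OF pc, of i] by (simp add: slice_word_eq)
      qed
    qed
    have "\<sigma> a < ?N" if a: "a \<in> cells d k" for a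
    proof -
      obtain i where i: "i < ?N" "a = slice_cell d k l (a ! l) i"
        using slice_cell_exhaust[OF assms a] .
      have c: "a ! l < k" using nth_cells[OF a assms] .
      then have "p (a ! l) permutes {..<?N}" using p by auto
      then have "slice_word d k \<sigma> l (a ! l) i < ?N"
        using w[OF c] i(1) permutes_in_image[of "p (a ! l)" "{..<?N}" i] by simp
      then show ?thesis using i by (simp add: slice_word_eq)
    qed
    then have "\<sigma> \<in> cells d k \<rightarrow>\<^sub>E {..<?N}" by (auto simp: \<sigma>_def)
    then have "\<sigma> \<in> direction_latin d k l"
      using w p by (auto simp: direction_latin_def)
    moreover have "(\<lambda>c\<in>{..<k}. slice_word d k \<sigma> l c) = p"
      using w p by (intro ext) (auto simp: PiE_def extensional_def)
    ultimately show "p \<in> (\<lambda>\<sigma>. \<lambda>c\<in>{..<k}. slice_word d k \<sigma> l c) ` direction_latin d k l" by blast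
  qed (auto simp: direction_latin_def)
qed

section \<open>Determinants arising from slices\<close>

text \<open>The determinant of the matrix formed from the columns of \<open>G\<close> chosen by
  \<open>v\<close>: a permutation of columns contributes its sign, a repeated column gives 0. By
  \<open>v'\<close>, injectivity on \<open>{..<N}\<close> is enough for
  \<open>permutes\<close>.\<close>

lemma sum_permutes_det:
  fixes G :: "'a :: comm_ring_1 mat"
  assumes G: "G \<in> carrier_mat N N" and v: "\<And>i. i < N \<Longrightarrow> v i < N"
    and v': "\<And>i. i \<ge> N \<Longrightarrow> v i = i"
  shows "(\<Sum>p | p permutes {..<N}. of_int (sign p) * (\<Prod>i<N. G $$ (p i, v i)))
    = (if v permutes {..<N} then of_int (sign v) * det G else 0)"
proof -
  \<comment> \<open>Row \<open>i\<close> of \<open>M\<close> is column \<open>v i\<close> of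
    \<open>G\<close>; the left-hand side is the Leibniz expansion of \<open>det M\<close>.\<close>
  define M where "M = mat N N (\<lambda>(i, j). G $$ (j, v i))"
  have M: "M \<in> carrier_mat N N" by (simp add: M_def)
  have "det M = (\<Sum>p | p permutes {..<N}. of_int (sign p) * (\<Prod>i<N. G $$ (p i, v i)))"
    unfolding det_def'[OF M]
    by (intro sum.cong prod.cong arg_cong2[where f = "(*)"])
      (auto simp: M_def atLeast0LessThan permutes_in_image[of _ "{..<N}", unfolded lessThan_iff])
  moreover have "det M = (if v permutes {..<N} then of_int (sign v) * det G else 0)"
  proof (cases "v permutes {..<N}")
    case True
    have "M = mat N N (\<lambda>(i, j). transpose_mat G $$ (v i, j))"
      unfolding M_def using G v by (intro cong_mat) auto
    then have "det M = of_int (sign v) * det (transpose_mat G)"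
      using det_permute_rows[of "transpose_mat G" N v] True G by (simp add: atLeast0LessThan)
    then show ?thesis using True det_transpose[OF G] by simp
  next
    case False
    have "\<not> inj_on v {..<N}"
    proof
      assume "inj_on v {..<N}"
      then have "bij_betw v {..<N} {..<N}"
        using v by (intro bij_betw_imageI endo_inj_surj) auto
      then have "v permutes {..<N}"
        by (rule bij_imp_permutes) (simp add: v')
      then show False using False by simp
    qed
    then obtain i j where ij: "i < N" "j < N" "i \<noteq> j" "v i = v j" by (auto simp: inj_on_def)
    have "det M = 0"
      by (rule det_identical_rows[OF M ij(3,1,2)]) (use ij in \<open>auto simp: M_def\<close>)
    then show ?thesis using False by simp
  qed
  ultimately show ?thesis by simp
qed

definition direction_sign :: "nat \<Rightarrow> nat \<Rightarrow> nat \<Rightarrow> (nat list \<Rightarrow> nat) \<Rightarrow> int" where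
  "direction_sign d k l \<sigma> = (\<Prod>c<k. sign (slice_word d k \<sigma> l c))"

text \<open>Invariance in one tensor factor: the sum splits into one determinant per slice, each
  equal to a sign because \<open>det G = 1\<close>, or to 0 if the word of \<open>\<tau>\<close> on
  that slice repeats a label.\<close>

lemma sum_direction_latin:
  assumes "l < d" and G: "G \<in> carrier_mat (k ^ (d - 1)) (k ^ (d - 1))" "det G = (1 :: complex)"
    and \<tau>: "\<tau> \<in> cells d k \<rightarrow>\<^sub>E {..<k ^ (d - 1)}"
  shows "(\<Sum>\<sigma>\<in>direction_latin d k l.
      of_int (direction_sign d k l \<sigma>) * (\<Prod>a\<in>cells d k. G $$ (\<sigma> a, \<tau> a)))
    = (if \<tau> \<in> direction_latin d k l then of_int (direction_sign d k l \<tau>) else 0)"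
    (is "?L = ?R")
proof -
  let ?N = "k ^ (d - 1)" and ?P = "{p. p permutes {..<k ^ (d - 1)}}"
  let ?h = "\<lambda>c p. of_int (sign p) * (\<Prod>i<?N. G $$ (p i, slice_word d k \<tau> l c i))"
  \<comment> \<open>The unreduced application exhibits the family of slice words as the new
    summation variable for the reindexing that follows.\<close>
  have "?L = (\<Sum>\<sigma>\<in>direction_latin d k l. \<Prod>c<k. ?h c ((\<lambda>c\<in>{..<k}. slice_word d k \<sigma> l c) c))"
    by (simp add: direction_sign_def prod.cells_slices[OF assms(1)] prod.distrib slice_word_eq)
  also have "\<dots> = (\<Sum>p\<in>{..<k} \<rightarrow>\<^sub>E ?P. \<Prod>c<k. ?h c (p c))"
    by (rule sum.reindex_bij_betw[OF bij_betw_slice_words[OF assms(1)]])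
  also have "\<dots> = (\<Prod>c<k. \<Sum>p\<in>?P. ?h c p)"
    by (subst prod_sum_PiE) (auto simp: finite_permutations)
  also have "\<dots> = (\<Prod>c<k. if slice_word d k \<tau> l c permutes {..<?N}
      then of_int (sign (slice_word d k \<tau> l c)) else 0)"
    using \<tau> slice_cell_in(1)[OF assms(1)] G
    by (intro prod.cong refl, subst sum_permutes_det[OF G(1)]) (auto simp: slice_word_eq)
  also have "\<dots> = ?R"
    using \<tau> by (auto simp: direction_latin_def direction_sign_def)
  finally show ?thesis .
qed

section \<open>The form and its invariance\<close>

definition cell_at :: "nat \<Rightarrow> (nat \<Rightarrow> nat list \<Rightarrow> nat) \<Rightarrow> nat list \<Rightarrow> nat list" where
  "cell_at d \<sigma> a = map (\<lambda>l. \<sigma> l a) [0..<d]"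

lemma cell_at_nth [simp]: "l < d \<Longrightarrow> cell_at d \<sigma> a ! l = \<sigma> l a"
  and length_cell_at [simp]: "length (cell_at d \<sigma> a) = d"
  by (simp_all add: cell_at_def)

definition latin_form :: "nat \<Rightarrow> nat \<Rightarrow> (nat list \<Rightarrow> complex) \<Rightarrow> complex" where
  "latin_form d k T =
    (\<Sum>\<sigma>\<in>Pi\<^sub>E {..<d} (direction_latin d k).
      (\<Prod>l<d. of_int (direction_sign d k l (\<sigma> l))) * (\<Prod>a\<in>cells d k. T (cell_at d \<sigma> a)))"

text \<open>Currying: \<open>d\<close> labellings by numbers are the same as one labelling by
  \<open>d\<close>-tuples. It converts a choice of tensor index at every cell into a family of
  labellings.\<close>

lemma bij_betw_cell_at:
  "bij_betw (\<lambda>\<tau>. \<lambda>a\<in>A. cell_at d \<tau> a)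
    ({..<d} \<rightarrow>\<^sub>E (A \<rightarrow>\<^sub>E {..<m})) (A \<rightarrow>\<^sub>E cells d m)"
proof (rule bij_betw_byWitness[where f' = "\<lambda>\<beta>. \<lambda>l\<in>{..<d}. \<lambda>a\<in>A. \<beta> a ! l"])
  show "\<forall>\<tau>\<in>{..<d} \<rightarrow>\<^sub>E (A \<rightarrow>\<^sub>E {..<m}).
      (\<lambda>l\<in>{..<d}. \<lambda>a\<in>A. (\<lambda>a\<in>A. cell_at d \<tau> a) a ! l) = \<tau>"
    by (auto simp: fun_eq_iff PiE_iff extensional_def restrict_def)
  show "\<forall>\<beta>\<in>A \<rightarrow>\<^sub>E cells d m.
      (\<lambda>a\<in>A. cell_at d (\<lambda>l\<in>{..<d}. \<lambda>a\<in>A. \<beta> a ! l) a) = \<beta>"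
  proof (intro ballI ext)
    fix \<beta> a assume \<beta>: "\<beta> \<in> A \<rightarrow>\<^sub>E cells d m"
    show "(\<lambda>a\<in>A. cell_at d (\<lambda>l\<in>{..<d}. \<lambda>a\<in>A. \<beta> a ! l) a) a = \<beta> a"
    proof (cases "a \<in> A")
      case True
      then have "length (\<beta> a) = d" using \<beta> by (auto simp: cells_def)
      then show ?thesis using True by (auto intro: nth_equalityI)
    next
      case False
      then show ?thesis using \<beta> by (auto simp: PiE_iff extensional_def)
    qed
  qed
  show "(\<lambda>\<tau>. \<lambda>a\<in>A. cell_at d \<tau> a) ` ({..<d} \<rightarrow>\<^sub>E (A \<rightarrow>\<^sub>E {..<m})) \<subseteq> A \<rightarrow>\<^sub>E cells d m"
    by (auto simp: cells_iff PiE_iff)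
  show "(\<lambda>\<beta>. \<lambda>l\<in>{..<d}. \<lambda>a\<in>A. \<beta> a ! l) ` (A \<rightarrow>\<^sub>E cells d m) \<subseteq> {..<d} \<rightarrow>\<^sub>E (A \<rightarrow>\<^sub>E {..<m})"
    by (auto simp: cells_iff PiE_iff)
qed

lemma direction_latin_subset: "direction_latin d k l \<subseteq> cells d k \<rightarrow>\<^sub>E {..<k ^ (d - 1)}"
  by (auto simp: direction_latin_def)

lemma cell_at_in_cells:
  assumes "\<sigma> \<in> Pi\<^sub>E {..<d} (direction_latin d k)" "a \<in> cells d k"
  shows "cell_at d \<sigma> a \<in> cells d (k ^ (d - 1))"
  unfolding cells_iff
proof (intro conjI allI impI)
  fix l assume l: "l < d"
  then have "\<sigma> l \<in> cells d k \<rightarrow>\<^sub>E {..<k ^ (d - 1)}"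
    using assms(1) by (intro subsetD[OF direction_latin_subset[of d k l]]) auto
  then show "cell_at d \<sigma> a ! l < k ^ (d - 1)"
    using assms(2) l by auto
qed simp

text \<open>Expanding the action introduces a second family \<open>\<tau>\<close> of labellings.
  After exchanging the sums, the sum over \<open>\<sigma>\<close> is a product over directions, to
  which \<open>sum_direction_latin\<close> applies.\<close>

lemma latin_form_tensor_act:
  assumes g: "\<forall>l<d. g l \<in> SL (k ^ (d - 1))"
  shows "latin_form d k (tensor_act d (k ^ (d - 1)) g T) = latin_form d k T"
proof -
  let ?N = "k ^ (d - 1)" and ?P = "Pi\<^sub>E {..<d} (direction_latin d k)"
  let ?Q = "{..<d} \<rightarrow>\<^sub>E (cells d k \<rightarrow>\<^sub>E {..<k ^ (d - 1)})"
  let ?s = "\<lambda>l \<sigma>. of_int (direction_sign d k l \<sigma>) :: complex"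
  let ?T = "\<lambda>\<tau>. \<Prod>a\<in>cells d k. T (cell_at d \<tau> a)"
  have fin: "finite ?P" "finite ?Q" by (auto intro!: finite_PiE)
  have sub: "?P \<subseteq> ?Q" using direction_latin_subset by (intro PiE_mono) auto
  \<comment> \<open>Each factor is a sum over tensor indices, so \<open>\<tau>\<close> ranges over
    arbitrary labellings, with no Latin condition.\<close>
  have exp: "(\<Prod>a\<in>cells d k. tensor_act d ?N g T (cell_at d \<sigma> a))
      = (\<Sum>\<tau>\<in>?Q. (\<Prod>l<d. \<Prod>a\<in>cells d k. g l $$ (\<sigma> l a, \<tau> l a)) * ?T \<tau>)"
    if \<sigma>: "\<sigma> \<in> ?P" for \<sigma>
  proof -
    let ?h = "\<lambda>a b. (\<Prod>l<d. g l $$ (\<sigma> l a, b ! l)) * T b"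
    have "(\<Prod>a\<in>cells d k. tensor_act d ?N g T (cell_at d \<sigma> a))
        = (\<Prod>a\<in>cells d k. \<Sum>b\<in>cells d ?N. ?h a b)"
      using cell_at_in_cells[OF \<sigma>] by (intro prod.cong) (simp_all add: tensor_act_def)
    also have "\<dots> = (\<Sum>\<beta>\<in>cells d k \<rightarrow>\<^sub>E cells d ?N. \<Prod>a\<in>cells d k. ?h a (\<beta> a))"
      by (rule prod_sum_PiE) simp_all
    also have "\<dots> = (\<Sum>\<tau>\<in>?Q. \<Prod>a\<in>cells d k. ?h a ((\<lambda>a\<in>cells d k. cell_at d \<tau> a) a))"
      by (rule sum.reindex_bij_betw[OF bij_betw_cell_at, symmetric])
    also have "\<dots> = (\<Sum>\<tau>\<in>?Q. (\<Prod>l<d. \<Prod>a\<in>cells d k. g l $$ (\<sigma> l a, \<tau> l a)) * ?T \<tau>)"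
    proof (rule sum.cong[OF refl])
      fix \<tau>
      have "(\<Prod>a\<in>cells d k. ?h a ((\<lambda>a\<in>cells d k. cell_at d \<tau> a) a))
          = (\<Prod>a\<in>cells d k. (\<Prod>l<d. g l $$ (\<sigma> l a, \<tau> l a)) * T (cell_at d \<tau> a))"
        by (intro prod.cong) simp_all
      then show "(\<Prod>a\<in>cells d k. ?h a ((\<lambda>a\<in>cells d k. cell_at d \<tau> a) a))
          = (\<Prod>l<d. \<Prod>a\<in>cells d k. g l $$ (\<sigma> l a, \<tau> l a)) * ?T \<tau>"
        by (simp add: prod.distrib prod.swap[of _ "{..<d}"])
    qed
    finally show ?thesis .
  qed
  \<comment> \<open>The signed sum over \<open>\<sigma>\<close> cancels unless every
    \<open>\<tau> l\<close> is Latin in direction \<open>l\<close>, and then reproduces the sign of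
    \<open>\<tau>\<close>.\<close>
  have inner: "(\<Sum>\<sigma>\<in>?P. (\<Prod>l<d. ?s l (\<sigma> l)) * (\<Prod>l<d. \<Prod>a\<in>cells d k. g l $$ (\<sigma> l a, \<tau> l a)))
      = (if \<tau> \<in> ?P then \<Prod>l<d. ?s l (\<tau> l) else 0)" if \<tau>: "\<tau> \<in> ?Q" for \<tau>
  proof -
    have "(\<Sum>\<sigma>\<in>?P. (\<Prod>l<d. ?s l (\<sigma> l)) * (\<Prod>l<d. \<Prod>a\<in>cells d k. g l $$ (\<sigma> l a, \<tau> l a)))
        = (\<Sum>\<sigma>\<in>?P. \<Prod>l<d. ?s l (\<sigma> l) * (\<Prod>a\<in>cells d k. g l $$ (\<sigma> l a, \<tau> l a)))"
      by (simp add: prod.distrib)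
    also have "\<dots> = (\<Prod>l<d. \<Sum>\<rho>\<in>direction_latin d k l.
        ?s l \<rho> * (\<Prod>a\<in>cells d k. g l $$ (\<rho> a, \<tau> l a)))"
      by (rule prod_sum_PiE[symmetric]) simp_all
    also have "\<dots> = (\<Prod>l<d. if \<tau> l \<in> direction_latin d k l then ?s l (\<tau> l) else 0)"
    proof (rule prod.cong[OF refl])
      fix l assume l: "l \<in> {..<d}"
      show "(\<Sum>\<rho>\<in>direction_latin d k l. ?s l \<rho> * (\<Prod>a\<in>cells d k. g l $$ (\<rho> a, \<tau> l a)))
          = (if \<tau> l \<in> direction_latin d k l then ?s l (\<tau> l) else 0)"
        by (rule sum_direction_latin) (use l g \<tau> in \<open>auto simp: SL_def PiE_iff\<close>)
    qed
    also have "\<dots> = (if \<tau> \<in> ?P then \<Prod>l<d. ?s l (\<tau> l) else 0)"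
      using \<tau> by (auto simp: PiE_iff)
    finally show ?thesis .
  qed
  have "latin_form d k (tensor_act d ?N g T) = (\<Sum>\<sigma>\<in>?P. \<Sum>\<tau>\<in>?Q.
      (\<Prod>l<d. ?s l (\<sigma> l)) * (\<Prod>l<d. \<Prod>a\<in>cells d k. g l $$ (\<sigma> l a, \<tau> l a)) * ?T \<tau>)"
    unfolding latin_form_def by (intro sum.cong refl) (simp only: exp sum_distrib_left mult.assoc)
  also have "\<dots> = (\<Sum>\<tau>\<in>?Q. (if \<tau> \<in> ?P then \<Prod>l<d. ?s l (\<tau> l) else 0) * ?T \<tau>)"
    by (subst sum.swap) (intro sum.cong refl, simp only: sum_distrib_right[symmetric] inner)
  also have "\<dots> = (\<Sum>\<tau>\<in>?P. (if \<tau> \<in> ?P then \<Prod>l<d. ?s l (\<tau> l) else 0) * ?T \<tau>)"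
    by (rule sum.mono_neutral_right[OF fin(2) sub]) auto
  also have "\<dots> = latin_form d k T"
    unfolding latin_form_def by (intro sum.cong) auto
  finally show ?thesis .
qed

section \<open>Value at the unit tensor\<close>

definition unit_tensor :: "nat \<Rightarrow> nat \<Rightarrow> nat list \<Rightarrow> complex" where
  "unit_tensor d n = (\<lambda>b. of_bool (\<exists>j<n. b = replicate d j))"

text \<open>A term is nonzero only if the \<open>d\<close> labels of each cell coincide. Then all
  labellings are one function \<open>C\<close>, Latin in every direction, and the product of the
  direction signs is its hypercube sign.\<close>

lemma latin_form_unit_tensor:
  assumes "d > 0"
  shows "latin_form d k (unit_tensor d (k ^ (d - 1))) = of_int (AT d k)"
proof -
  let ?N = "k ^ (d - 1)" and ?P = "Pi\<^sub>E {..<d} (direction_latin d k)"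
  let ?t = "\<lambda>\<sigma>. (\<Prod>l<d. of_int (direction_sign d k l (\<sigma> l))) *
      (\<Prod>a\<in>cells d k. unit_tensor d ?N (cell_at d \<sigma> a))"
  let ?c = "\<lambda>C. \<lambda>l\<in>{..<d}. C"
  have sub: "?c ` latin_hypercubes d k \<subseteq> ?P"
    by (auto simp: latin_hypercubes_def direction_latin_def)
  have zero: "?t \<sigma> = 0" if \<sigma>: "\<sigma> \<in> ?P - ?c ` latin_hypercubes d k" for \<sigma>
  proof (rule ccontr)
    assume "?t \<sigma> \<noteq> 0"
    then have diag: "\<exists>j<?N. cell_at d \<sigma> a = replicate d j" if "a \<in> cells d k" for a
      using that by (auto simp: unit_tensor_def)
    have same: "\<sigma> l a = \<sigma> 0 a" if a: "a \<in> cells d k" and l: "l < d" for a l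
    proof -
      obtain j where "cell_at d \<sigma> a = replicate d j" using diag[OF a] by blast
      then have "cell_at d \<sigma> a ! l = cell_at d \<sigma> a ! 0" using l by simp
      then show ?thesis using l assms by simp
    qed
    have eq: "\<sigma> l = \<sigma> 0" if "l < d" for l
    proof (rule PiE_ext)
      have "\<sigma> l' \<in> cells d k \<rightarrow>\<^sub>E {..<?N}" if "l' < d" for l'
        using \<sigma> that by (intro subsetD[OF direction_latin_subset[of d k l']]) auto
      then show "\<sigma> l \<in> cells d k \<rightarrow>\<^sub>E {..<?N}" "\<sigma> 0 \<in> cells d k \<rightarrow>\<^sub>E {..<?N}"
        using that assms by blast+
    qed (simp add: same that)
    have "\<sigma> = ?c (\<sigma> 0)"
    proof
      fix l
      show "\<sigma> l = ?c (\<sigma> 0) l"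
      proof (cases "l < d")
        case True
        then show ?thesis using eq[OF True] by simp
      next
        case False
        then show ?thesis using \<sigma> by (auto simp: PiE_iff extensional_def)
      qed
    qed
    moreover have "\<sigma> l \<in> direction_latin d k l" if "l < d" for l
      using \<sigma> that by auto
    \<comment> \<open>The common labelling inherits the condition for direction \<open>l\<close>
      from \<open>\<sigma> l\<close>, hence satisfies it for all directions.\<close>
    then have "\<sigma> 0 \<in> direction_latin d k l" if "l < d" for l
      using eq[OF that] that by metis
    then have "\<sigma> 0 \<in> latin_hypercubes d k"
      using assms by (auto simp: latin_hypercubes_def direction_latin_def)
    ultimately show False using \<sigma> by blast
  qed
  have "latin_form d k (unit_tensor d ?N) = (\<Sum>\<sigma>\<in>?c ` latin_hypercubes d k. ?t \<sigma>)"
    unfolding latin_form_def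
    by (rule sum.mono_neutral_right[OF _ sub]) (use zero in \<open>auto intro!: finite_PiE\<close>)
  also have "\<dots> = (\<Sum>C\<in>latin_hypercubes d k. ?t (?c C))"
    using assms by (subst sum.reindex) (auto simp: inj_on_def fun_eq_iff restrict_def split: if_splits)
  also have "\<dots> = (\<Sum>C\<in>latin_hypercubes d k. of_int (hypercube_sign d k C))"
  proof (rule sum.cong[OF refl])
    fix C assume C: "C \<in> latin_hypercubes d k"
    have "cell_at d (?c C) a = replicate d (C a)" for a
      by (rule nth_equalityI) auto
    then have "unit_tensor d ?N (cell_at d (?c C) a) = 1" if "a \<in> cells d k" for a
      using C that by (auto simp: unit_tensor_def latin_hypercubes_def)
    then show "?t (?c C) = of_int (hypercube_sign d k C)"
      by (simp add: hypercube_sign_def direction_sign_def)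
  qed
  finally show ?thesis by (simp add: AT_def)
qed

section \<open>Padding from size \<open>n\<close> to size \<open>N\<close>\<close>

lemma cells_mono: "n \<le> N \<Longrightarrow> cells d n \<subseteq> cells d N"
  by (auto simp: cells_iff) (meson less_le_trans)

lemma replicate_in_cells: "d > 0 \<Longrightarrow> replicate d j \<in> cells d m \<longleftrightarrow> j < m"
  by (auto simp: cells_iff)

text \<open>The tensor \<open>T \<oplus> I\<close>: a coordinate whose index mixes labels below and
  above \<open>n\<close> is zero.\<close>

definition pad_tensor :: "nat \<Rightarrow> nat \<Rightarrow> nat \<Rightarrow> (nat list \<Rightarrow> complex) \<Rightarrow> nat list \<Rightarrow> complex" where
  "pad_tensor d n N T =
    (\<lambda>b. if b \<in> cells d n then T b else of_bool (\<exists>j\<in>{n..<N}. b = replicate d j))"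

lemma pad_unit_tensor:
  assumes "d > 0" "n \<le> N"
  shows "pad_tensor d n N (unit_tensor d n) = unit_tensor d N"
proof
  fix b
  show "pad_tensor d n N (unit_tensor d n) b = unit_tensor d N b"
  proof (cases "\<exists>j. b = replicate d j")
    case True
    then obtain j where b: "b = replicate d j" by blast
    have inj: "replicate d j = replicate d i \<longleftrightarrow> i = j" for i
      using assms(1) by (auto simp: replicate_eq_replicate)
    show ?thesis
      using assms by (auto simp: b pad_tensor_def unit_tensor_def replicate_in_cells inj)
  qed (auto simp: pad_tensor_def unit_tensor_def)
qed

definition pad_mat :: "nat \<Rightarrow> nat \<Rightarrow> complex mat \<Rightarrow> complex mat" where
  "pad_mat n N A = four_block_mat A (0\<^sub>m n (N - n)) (0\<^sub>m (N - n) n) (1\<^sub>m (N - n))"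

lemma pad_mat_SL:
  assumes "A \<in> SL n" "n \<le> N"
  shows "pad_mat n N A \<in> SL N"
proof -
  have A: "A \<in> carrier_mat n n" "det A = 1" using assms by (auto simp: SL_def)
  then have "pad_mat n N A \<in> carrier_mat (n + (N - n)) (n + (N - n))"
    unfolding pad_mat_def by (intro four_block_carrier_mat) auto
  moreover have "det (pad_mat n N A) = det A * det (1\<^sub>m (N - n))"
    unfolding pad_mat_def by (rule det_four_block_mat_lower_left_zero) (use A in auto)
  ultimately show ?thesis using A assms by (simp add: SL_def)
qed

lemma pad_mat_index:
  assumes "A \<in> carrier_mat n n" "n \<le> N" "i < N" "j < N"
  shows "pad_mat n N A $$ (i, j) = (if i < n \<and> j < n then A $$ (i, j) else of_bool (i = j))"
  using assms by (auto simp: pad_mat_def)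

text \<open>The block matrices \<open>A \<oplus> 1\<close> act on the two summands separately and
  fix the unit tensor on the second. The cases are an index \<open>a\<close> in the small block,
  another index over \<open>[N]\<close>, and an index outside, where both sides vanish.\<close>

lemma pad_tensor_act:
  assumes d: "d > 0" and nN: "n \<le> N" and g: "\<forall>l<d. g l \<in> SL n"
  shows "pad_tensor d n N (tensor_act d n g T) =
    tensor_act d N (\<lambda>l. pad_mat n N (g l)) (pad_tensor d n N T)"
proof
  fix a
  let ?h = "\<lambda>b. \<Prod>l<d. pad_mat n N (g l) $$ (a ! l, b ! l)"
  let ?p = "pad_tensor d n N T"
  have idx: "pad_mat n N (g l) $$ (a ! l, b ! l)
      = (if a ! l < n \<and> b ! l < n then g l $$ (a ! l, b ! l) else of_bool (a ! l = b ! l))"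
    if "l < d" "a \<in> cells d N" "b \<in> cells d N" for l b
    using that g nN by (intro pad_mat_index) (auto simp: SL_def nth_cells)
  have diag: "\<exists>j. n \<le> j \<and> j < N \<and> b = replicate d j" if "b \<notin> cells d n" "?p b \<noteq> 0" for b
    using that by (auto simp: pad_tensor_def split: if_splits)
  consider "a \<in> cells d n" | "a \<notin> cells d n" "a \<in> cells d N" | "a \<notin> cells d N" by blast
  then show "pad_tensor d n N (tensor_act d n g T) a = tensor_act d N (\<lambda>l. pad_mat n N (g l)) ?p a"
  proof cases
    case 1
    have aN: "a \<in> cells d N" using 1 cells_mono[OF nN] by blast
    \<comment> \<open>Outside the small block only diagonal indices with label at least
      \<open>n\<close> carry a nonzero entry, and these meet the zero block of the matrix in
      direction 0.\<close>
    have "(\<Sum>b\<in>cells d N. ?h b * ?p b) = (\<Sum>b\<in>cells d n. ?h b * ?p b)"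
    proof (rule sum.mono_neutral_right[OF finite_cells cells_mono[OF nN]], rule ballI)
      fix b assume b: "b \<in> cells d N - cells d n"
      show "?h b * ?p b = 0"
      proof (cases "?p b = 0")
        case False
        then obtain j where j: "n \<le> j" "b = replicate d j" using diag b by blast
        have "b ! 0 = j" using j d by simp
        then have "pad_mat n N (g 0) $$ (a ! 0, b ! 0) = 0"
          using idx[OF d aN, of b] b j(1) nth_cells[OF 1 d] by auto
        then have "?h b = 0" using d by (intro prod_zero) auto
        then show ?thesis by simp
      qed simp
    qed
    also have "\<dots> = (\<Sum>b\<in>cells d n. (\<Prod>l<d. g l $$ (a ! l, b ! l)) * T b)"
    proof (rule sum.cong[OF refl])
      fix b assume b: "b \<in> cells d n"
      then have "b \<in> cells d N" using cells_mono[OF nN] by blast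
      then have "?h b = (\<Prod>l<d. g l $$ (a ! l, b ! l))"
        using aN 1 b by (intro prod.cong) (auto simp: idx nth_cells)
      then show "?h b * ?p b = (\<Prod>l<d. g l $$ (a ! l, b ! l)) * T b"
        using b by (simp add: pad_tensor_def)
    qed
    finally show ?thesis using 1 aN by (simp add: tensor_act_def pad_tensor_def)
  next
    case 2
    then obtain m where m: "m < d" "\<not> a ! m < n" by (auto simp: cells_iff)
    \<comment> \<open>Since \<open>a ! m\<close> is at least \<open>n\<close>, every
      \<open>b\<close> in the small block meets a zero block in direction \<open>m\<close>. For the
      remaining diagonal \<open>b\<close> all matrix entries are those of the identity, leaving only
      \<open>b = a\<close>.\<close>
    have "?h b * ?p b = (if b = a then ?p a else 0)" if b: "b \<in> cells d N" for b
    proof (cases "b \<in> cells d n")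
      case True
      then have "pad_mat n N (g m) $$ (a ! m, b ! m) = 0"
        using idx[OF m(1) 2(2) b] m nth_cells[OF True m(1)] by auto
      then have "?h b = 0" using m by (intro prod_zero) auto
      then show ?thesis using True 2 by auto
    next
      case False
      show ?thesis
      proof (cases "?p b = 0")
        case nz: False
        then obtain j where j: "n \<le> j" "b = replicate d j" using diag False by blast
        have h: "?h b = (\<Prod>l<d. of_bool (a ! l = b ! l))"
        proof (rule prod.cong[OF refl])
          fix l assume "l \<in> {..<d}"
          then have l: "l < d" and "b ! l = j" using j by simp_all
          then show "pad_mat n N (g l) $$ (a ! l, b ! l) = of_bool (a ! l = b ! l)"
            using idx[OF l 2(2) b] j(1) by simp
        qed
        show ?thesis
        proof (cases "b = a")
          case True
          then show ?thesis using h by simp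
        next
          case ne: False
          then obtain l where "l < d" "a ! l \<noteq> b ! l"
            using b 2 by (auto simp: cells_iff list_eq_iff_nth_eq)
          then have "?h b = 0" unfolding h by (intro prod_zero) auto
          then show ?thesis using ne by simp
        qed
      qed auto
    qed
    then have "(\<Sum>b\<in>cells d N. ?h b * ?p b) = (\<Sum>b\<in>cells d N. if b = a then ?p a else 0)"
      by (intro sum.cong) auto
    also have "\<dots> = ?p a" using 2 by (simp add: sum.delta)
    finally show ?thesis using 2 by (simp add: tensor_act_def pad_tensor_def)
  next
    case 3
    then have "a \<notin> cells d n" using cells_mono[OF nN] by blast
    moreover have "a \<noteq> replicate d j" if "j < N" for j
      using 3 that d by (auto simp: replicate_in_cells)
    ultimately show ?thesis using 3 by (auto simp: tensor_act_def pad_tensor_def)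
  qed
qed

section \<open>Degree of the padded form\<close>

text \<open>Each of the \<open>k\<close> slice words is a permutation of \<open>[N]\<close>, so it
  takes exactly \<open>n\<close> values below \<open>n\<close>.\<close>

lemma card_small_entries:
  assumes "l < d" "n \<le> k ^ (d - 1)" "\<rho> \<in> direction_latin d k l"
  shows "card {a \<in> cells d k. \<rho> a < n} = n * k"
proof -
  let ?N = "k ^ (d - 1)"
  have slice: "(\<Sum>i<?N. of_bool (\<rho> (slice_cell d k l c i) < n)) = n" if c: "c < k" for c
  proof -
    let ?w = "slice_word d k \<rho> l c"
    have w: "?w permutes {..<?N}" using assms(3) c by (auto simp: direction_latin_def)
    have "(\<Sum>i<?N. of_bool (\<rho> (slice_cell d k l c i) < n)) = (\<Sum>i<?N. of_bool (?w i < n) :: nat)"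
      by (intro sum.cong) (auto simp: slice_word_eq)
    also have "\<dots> = (\<Sum>j<?N. of_bool (j < n))"
      using sum.permute[OF w, of "\<lambda>j. of_bool (j < n) :: nat", symmetric] by (simp only: o_def)
    also have "\<dots> = card ({..<?N} \<inter> {..<n})"
      by (simp add: sum.If_cases of_bool_def lessThan_def)
    also have "\<dots> = n"
      using assms(2) by (simp add: Int_absorb1 lessThan_subset_iff)
    finally show ?thesis .
  qed
  have "card {a \<in> cells d k. \<rho> a < n} = (\<Sum>a\<in>cells d k. of_bool (\<rho> a < n))"
    by (simp add: sum.If_cases of_bool_def Int_def)
  also have "\<dots> = (\<Sum>c<k. \<Sum>i<?N. of_bool (\<rho> (slice_cell d k l c i) < n))"
    by (rule sum.cells_slices[OF assms(1)])
  also have "\<dots> = n * k" using slice by simp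
  finally show ?thesis .
qed

lemma sum_fun_apply: "(\<Sum>x\<in>A. f x) y = (\<Sum>x\<in>A. f x y)"
  by (induction A rule: infinite_finite_induct) auto

text \<open>Each family \<open>\<sigma>\<close> contributes either zero, when some cell receives a
  mixed index, or a scalar multiple of a monomial whose degree is the number of cells labelled in
  the small block.\<close>

lemma latin_form_pad_homogeneous:
  assumes d: "d > 0" and n: "n \<le> k ^ (d - 1)"
  shows "(\<lambda>T. latin_form d k (pad_tensor d n (k ^ (d - 1)) T)) \<in> homogeneous_polys d n (n * k)"
proof -
  let ?N = "k ^ (d - 1)"
  let ?M = "\<lambda>\<sigma> T. \<Prod>a\<in>cells d k. pad_tensor d n ?N T (cell_at d \<sigma> a)"
  let ?c = "\<lambda>\<sigma>. \<Prod>l<d. of_int (direction_sign d k l (\<sigma> l))"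
  have mono: "?M \<sigma> \<in> homogeneous_polys d n (n * k)"
    if \<sigma>: "\<sigma> \<in> Pi\<^sub>E {..<d} (direction_latin d k)" for \<sigma>
  proof (cases "\<forall>a\<in>cells d k. cell_at d \<sigma> a \<in> cells d n \<or> (\<exists>j\<in>{n..<?N}. cell_at d \<sigma> a = replicate d j)")
    case False
    then obtain a where "a \<in> cells d k" "cell_at d \<sigma> a \<notin> cells d n"
      "\<not> (\<exists>j\<in>{n..<?N}. cell_at d \<sigma> a = replicate d j)" by blast
    then have "?M \<sigma> T = 0" for T
      by (intro prod_zero bexI[of _ a]) (auto simp: pad_tensor_def)
    then have "?M \<sigma> = 0" by (simp add: fun_eq_iff)
    then show ?thesis by (simp add: homogeneous_polys_def cfun.span_zero)
  next
    case True
    let ?A = "{a \<in> cells d k. cell_at d \<sigma> a \<in> cells d n}"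
    \<comment> \<open>The exponent of the coordinate \<open>b\<close> is the number of cells that
      receive the index \<open>b\<close>.\<close>
    let ?e = "\<lambda>b. card {a \<in> ?A. cell_at d \<sigma> a = b}"
    \<comment> \<open>With mixed indices excluded, the label in direction 0 alone decides the block,
      so \<open>card_small_entries\<close> gives the degree.\<close>
    have small: "cell_at d \<sigma> a \<in> cells d n \<longleftrightarrow> \<sigma> 0 a < n" if a: "a \<in> cells d k" for a
    proof
      assume "cell_at d \<sigma> a \<in> cells d n"
      then show "\<sigma> 0 a < n" using nth_cells[of "cell_at d \<sigma> a" d n 0] d by simp
    next
      assume lt: "\<sigma> 0 a < n"
      have "cell_at d \<sigma> a \<noteq> replicate d j" if "n \<le> j" for j
      proof
        assume "cell_at d \<sigma> a = replicate d j"
        then have "cell_at d \<sigma> a ! 0 = j" using d by simp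
        then show False using d lt that by simp
      qed
      then show "cell_at d \<sigma> a \<in> cells d n" using bspec[OF True a] by fastforce
    qed
    have "(\<Sum>b\<in>cells d n. ?e b) = card ?A"
      unfolding card_eq_sum by (rule sum.group) auto
    also have "\<dots> = card {a \<in> cells d k. \<sigma> 0 a < n}"
      using small by (intro arg_cong[where f = card]) auto
    also have "\<dots> = n * k"
      by (rule card_small_entries[OF d n]) (use \<sigma> d in auto)
    finally have deg: "(\<Sum>b\<in>cells d n. ?e b) = n * k" .
    have "?M \<sigma> T = (\<Prod>b\<in>cells d n. T b ^ ?e b)" for T
    proof -
      \<comment> \<open>Cells outside \<open>?A\<close> contribute a diagonal entry 1 of the unit
        tensor.\<close>
      have "?M \<sigma> T = (\<Prod>a\<in>?A. T (cell_at d \<sigma> a))"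
        by (rule prod.mono_neutral_cong_right) (use True in \<open>auto simp: pad_tensor_def\<close>)
      also have "\<dots> = (\<Prod>b\<in>cells d n. \<Prod>a | a \<in> ?A \<and> cell_at d \<sigma> a = b. T (cell_at d \<sigma> a))"
        by (rule prod.group[symmetric]) auto
      also have "\<dots> = (\<Prod>b\<in>cells d n. T b ^ ?e b)"
        by (intro prod.cong refl) simp
      finally show ?thesis .
    qed
    then have "?M \<sigma> = (\<lambda>T. \<Prod>b\<in>cells d n. T b ^ ?e b)" by blast
    then show ?thesis
      unfolding homogeneous_polys_def using deg
      by (intro cfun.span_base CollectI exI[of _ ?e] conjI)
  qed
  have "(\<lambda>T. latin_form d k (pad_tensor d n ?N T))
      = (\<Sum>\<sigma>\<in>Pi\<^sub>E {..<d} (direction_latin d k). fun_scale (?c \<sigma>) (?M \<sigma>))"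
    by (simp add: fun_eq_iff sum_fun_apply latin_form_def fun_scale_def)
  also have "\<dots> \<in> homogeneous_polys d n (n * k)"
    using mono unfolding homogeneous_polys_def
    by (intro cfun.span_sum cfun.span_scale)
  finally show ?thesis .
qed

section \<open>Finite dimension and conclusion\<close>

text \<open>A monomial depends only on its exponents at \<open>cells d n\<close>, each of which is
  at most \<open>m\<close>, so there are finitely many monomials.\<close>

lemma homogeneous_polys_finite_span:
  obtains B where "finite B" "homogeneous_polys d n m = cfun.span B"
proof
  let ?mon = "\<lambda>e T. \<Prod>a\<in>cells d n. T a ^ e a :: complex"
  let ?B = "{?mon e |e. (\<Sum>a\<in>cells d n. e a) = m}"
  show "homogeneous_polys d n m = cfun.span ?B" by (simp add: homogeneous_polys_def)
  have "?B \<subseteq> ?mon ` (cells d n \<rightarrow>\<^sub>E {..m})"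
  proof safe
    fix e :: "nat list \<Rightarrow> nat"
    have "e a \<le> (\<Sum>a\<in>cells d n. e a)" if "a \<in> cells d n" for a
      using that by (intro member_le_sum) auto
    then have "restrict e (cells d n) \<in> cells d n \<rightarrow>\<^sub>E {..\<Sum>a\<in>cells d n. e a}" by auto
    moreover have "?mon e = ?mon (restrict e (cells d n))" by simp
    ultimately show "?mon e \<in> ?mon ` (cells d n \<rightarrow>\<^sub>E {..\<Sum>a\<in>cells d n. e a})" by blast
  qed
  then show "finite ?B" by (rule finite_subset) (auto intro!: finite_PiE)
qed

text \<open>As \<open>card\<close> is 0 on infinite sets, a nonzero vector alone does not make
  \<open>dim\<close> positive; the finite spanning set \<open>B\<close> forces the basis to be
  finite.\<close>

lemma (in vector_space) dim_pos:
  assumes "finite B" "V \<subseteq> span B" "v \<in> V" "v \<noteq> 0"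
  shows "dim V > 0"
proof -
  obtain S where S: "S \<subseteq> V" "independent S" "V \<subseteq> span S" "card S = dim V"
    using basis_exists .
  have "finite S" using independent_span_bound[of B S] S assms by blast
  moreover have "S \<noteq> {}" using S(3) assms by auto
  ultimately show ?thesis using S(4) by (metis card_gt_0_iff)
qed

theorem theorem8p1:
  fixes d k :: nat
  assumes "d \<ge> 3" and "odd d"
    and "k > 0" and "even k"
    and "AT d k \<noteq> 0"
  shows "\<forall>n::nat. 1 \<le> n \<and> n \<le> k ^ (d - 1) \<longrightarrow> gen_kronecker d n k > 0"
proof (intro allI impI)
  fix n :: nat
  assume n: "1 \<le> n \<and> n \<le> k ^ (d - 1)"
  let ?N = "k ^ (d - 1)"
  let ?f = "\<lambda>T. latin_form d k (pad_tensor d n ?N T)"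
  have d: "d > 0" using assms(1) by simp
  have "?f (tensor_act d n g T) = ?f T" if "\<forall>l<d. g l \<in> SL n" for g T
  proof -
    have "?f (tensor_act d n g T)
        = latin_form d k (tensor_act d ?N (\<lambda>l. pad_mat n ?N (g l)) (pad_tensor d n ?N T))"
      using pad_tensor_act[OF d _ that] n by simp
    also have "\<dots> = ?f T"
      using that n by (intro latin_form_tensor_act) (simp add: pad_mat_SL)
    finally show ?thesis .
  qed
  then have "?f \<in> invariant_polys d n (n * k)"
    using latin_form_pad_homogeneous[OF d] n by (auto simp: invariant_polys_def)
  \<comment> \<open>Padding the unit tensor of size \<open>n\<close> gives the one of size
    \<open>N\<close>, where the form takes the value \<open>AT d k\<close>.\<close>
  moreover have "?f (unit_tensor d n) \<noteq> 0"
    using n assms(5) by (simp only: pad_unit_tensor[OF d] latin_form_unit_tensor[OF d] of_int_eq_0_iff not_False_eq_True)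
  then have "?f \<noteq> 0" by (metis zero_fun_apply)
  moreover obtain B where "finite B" "homogeneous_polys d n (n * k) = cfun.span B"
    by (rule homogeneous_polys_finite_span)
  ultimately show "gen_kronecker d n k > 0"
    unfolding gen_kronecker_def
    by (intro cfun.dim_pos[of B _ ?f]) (auto simp: invariant_polys_def)
qed

end
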